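(* Let $A=(A,\cdot,\circ)$ be any two-sided perfect skew brace. Then $\mathrm{Ann}(A/\mathrm{Ann}(A))=1$.
   Context: A skew brace is a set $A=(A,\cdot,\circ)$ with two group operations $\cdot$ and $\circ$ such that $a\circ(b\cdot c)=(a\circ b)\cdot a^{-1}\cdot(a\circ c)$ for all $a,b,c\in A$, where $a^{-1}$ is the inverse of $a$ in $(A,\cdot)$. The two groups share the same identity element, denoted $1$; the trivial subgroup $\{1\}$ is also written $1$. The skew brace $A$ is two-sided if also $(b\cdot c)\circ a=(b\circ a)\cdot a^{-1}\cdot(c\circ a)$ for all $a,b,c\in A$. For $a,b\in A$ put $a*b=a^{-1}\cdot(a\circ b)\cdot b^{-1}$; for subsets $X,Y\subseteq A$, $X*Y$ is the subgroup of $(A,\cdot)$ generated by all $x*y$ with $x\in X$, $y\in Y$. The skew brace $A$ is perfect if $A=A*A$. An ideal of $A$ is a subset $I$ that is a normal subgroup of both $(A,\cdot)$ and $(A,\circ)$ with $a\cdot I=a\circ I$ for all $a\in A$; then the coset space $A/I$ is naturally a (quotient) skew brace. The annihilator of $A$ is the ideal $\mathrm{Ann}(A)=\{a\in A\mid \forall x\in A:\ a*x=1=x*a\}\cap Z(A,\cdot)$, where $Z$ denotes the center of a group. *)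

theory Defs
  imports "HOL-Algebra.Coset" "HOL-Algebra.Generated_Groups"
begin

text \<open>
  A skew brace is given by its two groups: \<open>G\<close> carries the operation written as a dot in the
  literature and \<open>C\<close> the circle operation, both on the same underlying set.
\<close>

locale skew_brace = G: group G + C: group C for G (structure) and C (structure) +
  assumes carrier_eq: "carrier C = carrier G"
    and brace: "\<lbrakk>a \<in> carrier G; b \<in> carrier G; c \<in> carrier G\<rbrakk> \<Longrightarrow>
      a \<otimes>\<^bsub>C\<^esub> (b \<otimes>\<^bsub>G\<^esub> c) = (a \<otimes>\<^bsub>C\<^esub> b) \<otimes>\<^bsub>G\<^esub> inv\<^bsub>G\<^esub> a \<otimes>\<^bsub>G\<^esub> (a \<otimes>\<^bsub>C\<^esub> c)"

locale two_sided_skew_brace = skew_brace +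
  assumes right_brace: "\<lbrakk>a \<in> carrier G; b \<in> carrier G; c \<in> carrier G\<rbrakk> \<Longrightarrow>
      (b \<otimes>\<^bsub>G\<^esub> c) \<otimes>\<^bsub>C\<^esub> a = (b \<otimes>\<^bsub>C\<^esub> a) \<otimes>\<^bsub>G\<^esub> inv\<^bsub>G\<^esub> a \<otimes>\<^bsub>G\<^esub> (c \<otimes>\<^bsub>C\<^esub> a)"

definition brace_star ::
    "('a, 'b) monoid_scheme \<Rightarrow> ('a, 'c) monoid_scheme \<Rightarrow> 'a \<Rightarrow> 'a \<Rightarrow> 'a" where
  "brace_star G C a b = inv\<^bsub>G\<^esub> a \<otimes>\<^bsub>G\<^esub> (a \<otimes>\<^bsub>C\<^esub> b) \<otimes>\<^bsub>G\<^esub> inv\<^bsub>G\<^esub> b"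

definition brace_star_set ::
    "('a, 'b) monoid_scheme \<Rightarrow> ('a, 'c) monoid_scheme \<Rightarrow> 'a set \<Rightarrow> 'a set \<Rightarrow> 'a set" where
  "brace_star_set G C X Y = generate G {brace_star G C x y | x y. x \<in> X \<and> y \<in> Y}"

definition perfect_brace ::
    "('a, 'b) monoid_scheme \<Rightarrow> ('a, 'c) monoid_scheme \<Rightarrow> bool" where
  "perfect_brace G C \<longleftrightarrow> carrier G = brace_star_set G C (carrier G) (carrier G)"

definition group_center :: "('a, 'b) monoid_scheme \<Rightarrow> 'a set" where
  "group_center G = {z \<in> carrier G. \<forall>x \<in> carrier G. z \<otimes>\<^bsub>G\<^esub> x = x \<otimes>\<^bsub>G\<^esub> z}"

definition brace_ann ::
    "('a, 'b) monoid_scheme \<Rightarrow> ('a, 'c) monoid_scheme \<Rightarrow> 'a set" where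
  "brace_ann G C = {a \<in> carrier G. \<forall>x \<in> carrier G.
      brace_star G C a x = \<one>\<^bsub>G\<^esub> \<and> brace_star G C x a = \<one>\<^bsub>G\<^esub>} \<inter> group_center G"

definition brace_ideal ::
    "('a, 'b) monoid_scheme \<Rightarrow> ('a, 'c) monoid_scheme \<Rightarrow> 'a set \<Rightarrow> bool" where
  "brace_ideal G C I \<longleftrightarrow> I \<lhd> G \<and> I \<lhd> C \<and> (\<forall>a \<in> carrier G. a <#\<^bsub>G\<^esub> I = a <#\<^bsub>C\<^esub> I)"

text \<open>
  The quotient skew brace by an ideal \<open>I\<close> is the pair \<open>G Mod I\<close>, \<open>C Mod I\<close> of quotient groups.
  Their carriers are sets of right cosets, which coincide because \<open>I\<close> is normal in both groups.
  The lemmas below confirm that this pair is a skew brace and that the annihilator is an ideal.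
\<close>

context skew_brace
begin

lemma C_closed [simp]: "\<lbrakk>a \<in> carrier G; b \<in> carrier G\<rbrakk> \<Longrightarrow> a \<otimes>\<^bsub>C\<^esub> b \<in> carrier G"
  using C.m_closed carrier_eq by simp

lemma C_assoc:
  "\<lbrakk>a \<in> carrier G; b \<in> carrier G; c \<in> carrier G\<rbrakk> \<Longrightarrow>
    (a \<otimes>\<^bsub>C\<^esub> b) \<otimes>\<^bsub>C\<^esub> c = a \<otimes>\<^bsub>C\<^esub> (b \<otimes>\<^bsub>C\<^esub> c)"
  using C.m_assoc carrier_eq by simp

lemma one_eq: "\<one>\<^bsub>C\<^esub> = \<one>\<^bsub>G\<^esub>"
proof -
  let ?a = "\<one>\<^bsub>C\<^esub>"
  have a: "?a \<in> carrier G" using carrier_eq C.one_closed by simp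
  have i: "?a \<otimes>\<^bsub>C\<^esub> \<one>\<^bsub>G\<^esub> = \<one>\<^bsub>G\<^esub>" using carrier_eq by simp
  have "\<one>\<^bsub>G\<^esub> = \<one>\<^bsub>G\<^esub> \<otimes>\<^bsub>G\<^esub> inv\<^bsub>G\<^esub> ?a \<otimes>\<^bsub>G\<^esub> \<one>\<^bsub>G\<^esub>"
    using brace[OF a G.one_closed G.one_closed] i by simp
  then have "inv\<^bsub>G\<^esub> ?a = \<one>\<^bsub>G\<^esub>" using a by simp
  then show ?thesis using a by (metis G.inv_inv G.inv_one)
qed

lemma ideal_r_coset_eq:
  assumes "brace_ideal G C I" "a \<in> carrier G"
  shows "I #>\<^bsub>C\<^esub> a = I #>\<^bsub>G\<^esub> a"
  using assms normal.coset_eq[of I G] normal.coset_eq[of I C] carrier_eq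
  unfolding brace_ideal_def by auto

lemma quotient_skew_brace:
  assumes I: "brace_ideal G C I"
  shows "skew_brace (G Mod I) (C Mod I)"
proof -
  have n: "normal I G" and m: "normal I C" using I by (auto simp: brace_ideal_def)
  note e = ideal_r_coset_eq[OF I]
  have sG: "(I #>\<^bsub>G\<^esub> a) <#>\<^bsub>G\<^esub> (I #>\<^bsub>G\<^esub> b) = I #>\<^bsub>G\<^esub> (a \<otimes>\<^bsub>G\<^esub> b)"
    if "a \<in> carrier G" "b \<in> carrier G" for a b using normal.rcos_sum[OF n that] .
  have sC: "(I #>\<^bsub>G\<^esub> a) <#>\<^bsub>C\<^esub> (I #>\<^bsub>G\<^esub> b) = I #>\<^bsub>G\<^esub> (a \<otimes>\<^bsub>C\<^esub> b)"
    if "a \<in> carrier G" "b \<in> carrier G" for a b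
    using normal.rcos_sum[OF m, of a b] that e carrier_eq by simp
  have iG: "inv\<^bsub>G Mod I\<^esub> (I #>\<^bsub>G\<^esub> a) = I #>\<^bsub>G\<^esub> inv\<^bsub>G\<^esub> a" if a: "a \<in> carrier G" for a
  proof -
    have "I #>\<^bsub>G\<^esub> a \<in> carrier (G Mod I)"
      using a by (auto simp: FactGroup_def RCOSETS_def)
    then show ?thesis using normal.inv_FactGroup[OF n] normal.rcos_inv[OF n a] by simp
  qed
  have c: "carrier (C Mod I) = carrier (G Mod I)"
    using e carrier_eq by (simp add: FactGroup_def RCOSETS_def)
  show ?thesis
  proof (intro skew_brace.intro skew_brace_axioms.intro)
    show "group (G Mod I)" "group (C Mod I)"
      using normal.factorgroup_is_group n m by blast+
    show "carrier (C Mod I) = carrier (G Mod I)" by (rule c)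
    fix X Y Z assume "X \<in> carrier (G Mod I)" "Y \<in> carrier (G Mod I)" "Z \<in> carrier (G Mod I)"
    then obtain x y z where x: "x \<in> carrier G" "X = I #>\<^bsub>G\<^esub> x"
      and y: "y \<in> carrier G" "Y = I #>\<^bsub>G\<^esub> y" and z: "z \<in> carrier G" "Z = I #>\<^bsub>G\<^esub> z"
      by (auto simp: FactGroup_def RCOSETS_def)
    have i: "inv\<^bsub>G Mod I\<^esub> X = I #>\<^bsub>G\<^esub> inv\<^bsub>G\<^esub> x" using iG x by simp
    show "X \<otimes>\<^bsub>C Mod I\<^esub> (Y \<otimes>\<^bsub>G Mod I\<^esub> Z) =
        (X \<otimes>\<^bsub>C Mod I\<^esub> Y) \<otimes>\<^bsub>G Mod I\<^esub> inv\<^bsub>G Mod I\<^esub> X \<otimes>\<^bsub>G Mod I\<^esub> (X \<otimes>\<^bsub>C Mod I\<^esub> Z)"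
      unfolding i using x y z by (simp add: sG sC brace)
  qed
qed

lemma star_eq_one_iff:
  assumes "a \<in> carrier G" "b \<in> carrier G"
  shows "brace_star G C a b = \<one>\<^bsub>G\<^esub> \<longleftrightarrow> a \<otimes>\<^bsub>C\<^esub> b = a \<otimes>\<^bsub>G\<^esub> b"
proof
  assume h: "brace_star G C a b = \<one>\<^bsub>G\<^esub>"
  have "a \<otimes>\<^bsub>C\<^esub> b = a \<otimes>\<^bsub>G\<^esub> brace_star G C a b \<otimes>\<^bsub>G\<^esub> b"
    using assms by (simp add: brace_star_def G.m_assoc G.inv_solve_left[symmetric])
  then show "a \<otimes>\<^bsub>C\<^esub> b = a \<otimes>\<^bsub>G\<^esub> b" using h assms by simp
next
  assume "a \<otimes>\<^bsub>C\<^esub> b = a \<otimes>\<^bsub>G\<^esub> b"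
  then show "brace_star G C a b = \<one>\<^bsub>G\<^esub>"
    using assms by (simp add: brace_star_def G.m_assoc)
qed

lemma ann_iff:
  "a \<in> brace_ann G C \<longleftrightarrow> a \<in> carrier G \<and> (\<forall>x \<in> carrier G.
     a \<otimes>\<^bsub>C\<^esub> x = a \<otimes>\<^bsub>G\<^esub> x \<and> x \<otimes>\<^bsub>C\<^esub> a = x \<otimes>\<^bsub>G\<^esub> a \<and> x \<otimes>\<^bsub>G\<^esub> a = a \<otimes>\<^bsub>G\<^esub> x)"
  unfolding brace_ann_def group_center_def mem_Collect_eq Int_iff
  using star_eq_one_iff by metis

lemma
  assumes "a \<in> brace_ann G C"
  shows ann_closed: "a \<in> carrier G"
    and ann_l: "x \<in> carrier G \<Longrightarrow> a \<otimes>\<^bsub>C\<^esub> x = a \<otimes>\<^bsub>G\<^esub> x"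
    and ann_r: "x \<in> carrier G \<Longrightarrow> x \<otimes>\<^bsub>C\<^esub> a = x \<otimes>\<^bsub>G\<^esub> a"
    and ann_comm: "x \<in> carrier G \<Longrightarrow> x \<otimes>\<^bsub>G\<^esub> a = a \<otimes>\<^bsub>G\<^esub> x"
  using assms unfolding ann_iff by blast+

lemma ann_m_closed:
  assumes a: "a \<in> brace_ann G C" and b: "b \<in> brace_ann G C"
  shows "a \<otimes>\<^bsub>G\<^esub> b \<in> brace_ann G C"
proof -
  note A = ann_closed[OF a] ann_l[OF a] ann_r[OF a] and B = ann_closed[OF b] ann_l[OF b] ann_r[OF b]
  show ?thesis unfolding ann_iff
  proof (intro conjI ballI)
    show "a \<otimes>\<^bsub>G\<^esub> b \<in> carrier G" using A B by simp
    fix x assume x: "x \<in> carrier G"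
    have "(a \<otimes>\<^bsub>C\<^esub> b) \<otimes>\<^bsub>C\<^esub> x = a \<otimes>\<^bsub>C\<^esub> (b \<otimes>\<^bsub>C\<^esub> x)"
      using C_assoc A(1) B(1) x by blast
    then show "a \<otimes>\<^bsub>G\<^esub> b \<otimes>\<^bsub>C\<^esub> x = a \<otimes>\<^bsub>G\<^esub> b \<otimes>\<^bsub>G\<^esub> x"
      using A B x by (simp add: G.m_assoc)
    have "x \<otimes>\<^bsub>C\<^esub> (a \<otimes>\<^bsub>C\<^esub> b) = (x \<otimes>\<^bsub>C\<^esub> a) \<otimes>\<^bsub>C\<^esub> b"
      using C_assoc[OF x A(1) B(1)] by simp
    then show "x \<otimes>\<^bsub>C\<^esub> (a \<otimes>\<^bsub>G\<^esub> b) = x \<otimes>\<^bsub>G\<^esub> (a \<otimes>\<^bsub>G\<^esub> b)"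
      using A B x by (simp add: G.m_assoc)
    have "x \<otimes>\<^bsub>G\<^esub> (a \<otimes>\<^bsub>G\<^esub> b) = a \<otimes>\<^bsub>G\<^esub> (x \<otimes>\<^bsub>G\<^esub> b)"
      using A(1) B(1) x by (simp add: G.m_assoc[symmetric] ann_comm[OF a x])
    also have "\<dots> = a \<otimes>\<^bsub>G\<^esub> b \<otimes>\<^bsub>G\<^esub> x"
      using A(1) B(1) x by (simp add: G.m_assoc ann_comm[OF b x])
    finally show "x \<otimes>\<^bsub>G\<^esub> (a \<otimes>\<^bsub>G\<^esub> b) = a \<otimes>\<^bsub>G\<^esub> b \<otimes>\<^bsub>G\<^esub> x" .
  qed
qed

lemma ann_inv_closed:
  assumes a: "a \<in> brace_ann G C"
  shows "inv\<^bsub>G\<^esub> a \<in> brace_ann G C"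
  unfolding ann_iff
proof (intro conjI ballI)
  note A = ann_closed[OF a] ann_l[OF a] ann_r[OF a]
  show i: "inv\<^bsub>G\<^esub> a \<in> carrier G" using A by simp
  fix x assume x: "x \<in> carrier G"
  have e: "inv\<^bsub>G\<^esub> a \<otimes>\<^bsub>C\<^esub> a = \<one>\<^bsub>C\<^esub>" "a \<otimes>\<^bsub>C\<^esub> inv\<^bsub>G\<^esub> a = \<one>\<^bsub>C\<^esub>" using A i one_eq by auto
  have "a \<otimes>\<^bsub>C\<^esub> (inv\<^bsub>G\<^esub> a \<otimes>\<^bsub>G\<^esub> x) = x"
    using A i x by (simp add: G.m_assoc[symmetric])
  then have "inv\<^bsub>G\<^esub> a \<otimes>\<^bsub>C\<^esub> x = (inv\<^bsub>G\<^esub> a \<otimes>\<^bsub>C\<^esub> a) \<otimes>\<^bsub>C\<^esub> (inv\<^bsub>G\<^esub> a \<otimes>\<^bsub>G\<^esub> x)"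
    using C_assoc[OF i A(1), of "inv\<^bsub>G\<^esub> a \<otimes>\<^bsub>G\<^esub> x"] i x by simp
  then show "inv\<^bsub>G\<^esub> a \<otimes>\<^bsub>C\<^esub> x = inv\<^bsub>G\<^esub> a \<otimes>\<^bsub>G\<^esub> x"
    using e i x carrier_eq by simp
  have "(x \<otimes>\<^bsub>G\<^esub> inv\<^bsub>G\<^esub> a) \<otimes>\<^bsub>C\<^esub> a = x"
    using A i x by (simp add: G.m_assoc)
  then have "x \<otimes>\<^bsub>C\<^esub> inv\<^bsub>G\<^esub> a = (x \<otimes>\<^bsub>G\<^esub> inv\<^bsub>G\<^esub> a) \<otimes>\<^bsub>C\<^esub> (a \<otimes>\<^bsub>C\<^esub> inv\<^bsub>G\<^esub> a)"
    using C_assoc[OF _ A(1) i, of "x \<otimes>\<^bsub>G\<^esub> inv\<^bsub>G\<^esub> a"] i x by simp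
  then show "x \<otimes>\<^bsub>C\<^esub> inv\<^bsub>G\<^esub> a = x \<otimes>\<^bsub>G\<^esub> inv\<^bsub>G\<^esub> a"
    using e i x carrier_eq by simp
  have "x = a \<otimes>\<^bsub>G\<^esub> (x \<otimes>\<^bsub>G\<^esub> inv\<^bsub>G\<^esub> a)"
    using A(1) x by (simp add: G.m_assoc[symmetric] ann_comm[OF a x, symmetric]) (simp add: G.m_assoc)
  then show "x \<otimes>\<^bsub>G\<^esub> inv\<^bsub>G\<^esub> a = inv\<^bsub>G\<^esub> a \<otimes>\<^bsub>G\<^esub> x"
    using A(1) x G.inv_solve_left[of "x \<otimes>\<^bsub>G\<^esub> inv\<^bsub>G\<^esub> a" a x] by blast
qed

lemma ann_ideal: "brace_ideal G C (brace_ann G C)"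
proof -
  let ?Z = "brace_ann G C"
  have sub: "?Z \<subseteq> carrier G" using ann_iff by blast
  have one: "\<one>\<^bsub>G\<^esub> \<in> ?Z"
    unfolding ann_iff using carrier_eq one_eq C.l_one C.r_one by auto
  have Cinv: "inv\<^bsub>C\<^esub> a = inv\<^bsub>G\<^esub> a" if a: "a \<in> ?Z" for a
  proof -
    have ac: "a \<in> carrier G" using a sub by blast
    have "inv\<^bsub>G\<^esub> a \<otimes>\<^bsub>C\<^esub> a = inv\<^bsub>G\<^esub> a \<otimes>\<^bsub>G\<^esub> a"
      using ann_l[OF ann_inv_closed[OF a] ac] .
    then have "inv\<^bsub>G\<^esub> a \<otimes>\<^bsub>C\<^esub> a = \<one>\<^bsub>C\<^esub>"
      using ac one_eq by simp
    then show ?thesis using C.inv_equality ac carrier_eq by simp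
  qed
  have sG: "subgroup ?Z G"
    using sub one ann_m_closed ann_inv_closed by (intro subgroup.intro) auto
  have sC: "subgroup ?Z C"
  proof (intro subgroup.intro)
    show "?Z \<subseteq> carrier C" using sub carrier_eq by simp
    show "\<one>\<^bsub>C\<^esub> \<in> ?Z" using one one_eq by simp
    show "a \<otimes>\<^bsub>C\<^esub> b \<in> ?Z" if "a \<in> ?Z" "b \<in> ?Z" for a b
      using that ann_m_closed[OF that] ann_l ann_closed by simp
    show "inv\<^bsub>C\<^esub> a \<in> ?Z" if "a \<in> ?Z" for a
      using that ann_inv_closed Cinv by simp
  qed
  have lr: "?Z #>\<^bsub>G\<^esub> a = a <#\<^bsub>G\<^esub> ?Z" "?Z #>\<^bsub>C\<^esub> a = a <#\<^bsub>C\<^esub> ?Z" "a <#\<^bsub>G\<^esub> ?Z = a <#\<^bsub>C\<^esub> ?Z"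
    if a: "a \<in> carrier G" for a
  proof -
    have "h \<otimes>\<^bsub>G\<^esub> a = a \<otimes>\<^bsub>G\<^esub> h" "h \<otimes>\<^bsub>C\<^esub> a = a \<otimes>\<^bsub>C\<^esub> h" "a \<otimes>\<^bsub>G\<^esub> h = a \<otimes>\<^bsub>C\<^esub> h"
      if "h \<in> ?Z" for h
      using ann_l[OF that a] ann_r[OF that a] ann_comm[OF that a] by simp_all
    then show "?Z #>\<^bsub>G\<^esub> a = a <#\<^bsub>G\<^esub> ?Z" "?Z #>\<^bsub>C\<^esub> a = a <#\<^bsub>C\<^esub> ?Z" "a <#\<^bsub>G\<^esub> ?Z = a <#\<^bsub>C\<^esub> ?Z"
      by (auto simp: r_coset_def l_coset_def)
  qed
  show ?thesis unfolding brace_ideal_def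
    using sG sC lr carrier_eq
    by (auto intro!: normal.intro normal_axioms.intro G.is_group C.is_group)
qed

end

end

theory Submission
  imports Defs
begin

text \<open>
  Let \<open>Z\<close> be the annihilator of \<open>A\<close> and let \<open>a\<close> represent an annihilating element of \<open>A / Z\<close>.
  This says that the three maps
  \<open>x \<mapsto> a * x\<close>, \<open>x \<mapsto> x * a\<close> and \<open>x \<mapsto> a x a\<^sup>-\<^sup>1 x\<^sup>-\<^sup>1\<close> take values in \<open>Z\<close>, and the aim is to
  show that all three are constantly \<open>1\<close>.

  The argument is the skew brace analogue of Gruen's lemma, by which a perfect group modulo its
  center has trivial center.  A map that is multiplicative for both operations of \<open>A\<close>, with values
  in one group, sends \<open>x * y = x\<^sup>-\<^sup>1 (x \<circ> y) y\<^sup>-\<^sup>1\<close> to \<open>1\<close>; as such elements generate a perfect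
  skew brace, the map is trivial (\<open>perfect_hom_trivial\<close>).  So it is enough to see that the
  three maps are multiplicative for both operations.  For the first two
  (\<open>left_star_trivial\<close>, \<open>right_star_trivial\<close>) the left brace law settles one of the operations and
  the right brace law the other, because factors from \<open>Z\<close> can be moved freely through products.
  Once these two maps are trivial, left and right multiplication by \<open>a\<close> are the same for both
  operations, so the commutator map is at the same time
  the commutator map of the circle group.  A commutator map with central values is multiplicative,
  hence it is multiplicative for both operations (\<open>commutator_trivial\<close>).
\<close>

section \<open>Skew braces and their annihilator\<close>

context skew_brace
begin

lemma ann_left_comm:
  assumes "z \<in> brace_ann G C" "x \<in> carrier G" "y \<in> carrier G"
  shows "x \<otimes>\<^bsub>G\<^esub> (z \<otimes>\<^bsub>G\<^esub> y) = z \<otimes>\<^bsub>G\<^esub> (x \<otimes>\<^bsub>G\<^esub> y)"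
  using assms ann_closed ann_comm[of z x] by (metis G.m_assoc)

lemma ann_circ_left:
  assumes z: "z \<in> brace_ann G C" and x: "x \<in> carrier G" and y: "y \<in> carrier G"
  shows "(z \<otimes>\<^bsub>G\<^esub> x) \<otimes>\<^bsub>C\<^esub> y = z \<otimes>\<^bsub>G\<^esub> (x \<otimes>\<^bsub>C\<^esub> y)"
  using C_assoc[OF ann_closed[OF z] x y] ann_l[OF z] x y by simp

lemma ann_circ_right:
  assumes z: "z \<in> brace_ann G C" and x: "x \<in> carrier G" and y: "y \<in> carrier G"
  shows "x \<otimes>\<^bsub>C\<^esub> (z \<otimes>\<^bsub>G\<^esub> y) = z \<otimes>\<^bsub>G\<^esub> (x \<otimes>\<^bsub>C\<^esub> y)"
proof -
  have "x \<otimes>\<^bsub>C\<^esub> (z \<otimes>\<^bsub>G\<^esub> y) = (x \<otimes>\<^bsub>C\<^esub> z) \<otimes>\<^bsub>C\<^esub> y"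
    using C_assoc[OF x ann_closed[OF z] y] ann_l[OF z y] by simp
  also have "\<dots> = z \<otimes>\<^bsub>G\<^esub> (x \<otimes>\<^bsub>C\<^esub> y)"
    using ann_r[OF z x] ann_comm[OF z x] ann_circ_left[OF z x y] by simp
  finally show ?thesis .
qed

text \<open>
  The quotient of \<open>G\<close> by the kernel is the image, on which both operations agree; so the kernel
  contains every \<open>x * y\<close>.
\<close>

lemma perfect_hom_trivial:
  assumes perfect: "perfect_brace G C"
    and hom: "group_hom G H \<phi>"
    and circ: "\<And>x y. \<lbrakk>x \<in> carrier G; y \<in> carrier G\<rbrakk> \<Longrightarrow> \<phi> (x \<otimes>\<^bsub>C\<^esub> y) = \<phi> x \<otimes>\<^bsub>H\<^esub> \<phi> y"
    and x: "x \<in> carrier G"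
  shows "\<phi> x = \<one>\<^bsub>H\<^esub>"
proof -
  interpret \<phi>: group_hom G H \<phi> by (rule hom)
  have "\<phi> (brace_star G C u v) = \<one>\<^bsub>H\<^esub>" if "u \<in> carrier G" "v \<in> carrier G" for u v
    using that by (simp add: brace_star_def circ \<phi>.H.m_assoc[symmetric])
  then have "{brace_star G C u v | u v. u \<in> carrier G \<and> v \<in> carrier G} \<subseteq> kernel G H \<phi>"
    by (auto simp: kernel_def brace_star_def)
  then have "generate G {brace_star G C u v | u v. u \<in> carrier G \<and> v \<in> carrier G} \<subseteq> kernel G H \<phi>"
    using \<phi>.subgroup_kernel G.generate_subgroup_incl by blast
  then show ?thesis
    using perfect x unfolding perfect_brace_def brace_star_set_def by (auto simp: kernel_def)
qed

section \<open>Representatives of annihilating elements of the quotient\<close>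

text \<open>
  The second term of the annihilator series, that is, the preimage of the annihilator of the
  quotient by the annihilator.  Each condition exhibits the factor that measures how far \<open>a\<close> is from
  annihilating \<open>x\<close> on the far left, where a factor from the annihilator may always be moved.
\<close>

definition second_ann :: "'a set" where
  "second_ann = {a \<in> carrier G. \<forall>x \<in> carrier G.
     (\<exists>z \<in> brace_ann G C. a \<otimes>\<^bsub>C\<^esub> x = z \<otimes>\<^bsub>G\<^esub> (a \<otimes>\<^bsub>G\<^esub> x)) \<and>
     (\<exists>z \<in> brace_ann G C. x \<otimes>\<^bsub>C\<^esub> a = z \<otimes>\<^bsub>G\<^esub> (x \<otimes>\<^bsub>G\<^esub> a)) \<and>
     (\<exists>z \<in> brace_ann G C. a \<otimes>\<^bsub>G\<^esub> x = z \<otimes>\<^bsub>G\<^esub> (x \<otimes>\<^bsub>G\<^esub> a))}"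

lemma quotient_ann_representative:
  assumes X: "X \<in> brace_ann (G Mod brace_ann G C) (C Mod brace_ann G C)"
  obtains a where "a \<in> second_ann" "X = brace_ann G C #>\<^bsub>G\<^esub> a"
proof -
  let ?Z = "brace_ann G C"
  interpret Q: skew_brace "G Mod ?Z" "C Mod ?Z"
    by (rule quotient_skew_brace[OF ann_ideal])
  have n: "normal ?Z G" and m: "normal ?Z C" and s: "subgroup ?Z G"
    using ann_ideal normal_imp_subgroup by (auto simp: brace_ideal_def)
  have mult: "(?Z #>\<^bsub>G\<^esub> u) <#>\<^bsub>G\<^esub> (?Z #>\<^bsub>G\<^esub> v) = ?Z #>\<^bsub>G\<^esub> (u \<otimes>\<^bsub>G\<^esub> v)"
    and circ: "(?Z #>\<^bsub>G\<^esub> u) <#>\<^bsub>C\<^esub> (?Z #>\<^bsub>G\<^esub> v) = ?Z #>\<^bsub>G\<^esub> (u \<otimes>\<^bsub>C\<^esub> v)"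
    if "u \<in> carrier G" "v \<in> carrier G" for u v
    using normal.rcos_sum[OF n that] normal.rcos_sum[OF m, of u v] that
      ideal_r_coset_eq[OF ann_ideal] carrier_eq
    by simp_all
  have quotient: "?Z #>\<^bsub>G\<^esub> u \<in> carrier (G Mod ?Z)" if "u \<in> carrier G" for u
    using that by (auto simp: FactGroup_def RCOSETS_def)
  have factor: "\<exists>z \<in> ?Z. u = z \<otimes>\<^bsub>G\<^esub> v" if "u \<in> carrier G" "?Z #>\<^bsub>G\<^esub> u = ?Z #>\<^bsub>G\<^esub> v" for u v
    using G.rcos_self[OF that(1) s] that(2) by (auto simp: r_coset_def)
  obtain a where a: "a \<in> carrier G" and Xa: "X = ?Z #>\<^bsub>G\<^esub> a"
    using Q.ann_closed[OF X] by (auto simp: FactGroup_def RCOSETS_def)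
  have "a \<in> second_ann"
    unfolding second_ann_def
  proof (intro CollectI conjI ballI a)
    fix x assume x: "x \<in> carrier G"
    note qx = quotient[OF x]
    show "\<exists>z \<in> ?Z. a \<otimes>\<^bsub>C\<^esub> x = z \<otimes>\<^bsub>G\<^esub> (a \<otimes>\<^bsub>G\<^esub> x)"
      using Q.ann_l[OF X qx] a x by (intro factor) (simp_all add: Xa mult circ)
    show "\<exists>z \<in> ?Z. x \<otimes>\<^bsub>C\<^esub> a = z \<otimes>\<^bsub>G\<^esub> (x \<otimes>\<^bsub>G\<^esub> a)"
      using Q.ann_r[OF X qx] a x by (intro factor) (simp_all add: Xa mult circ)
    show "\<exists>z \<in> ?Z. a \<otimes>\<^bsub>G\<^esub> x = z \<otimes>\<^bsub>G\<^esub> (x \<otimes>\<^bsub>G\<^esub> a)"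
      using Q.ann_comm[OF X qx] a x by (intro factor) (simp_all add: Xa mult)
  qed
  then show thesis using Xa that by blast
qed

end

section \<open>Triviality of the star and commutator maps\<close>

context two_sided_skew_brace
begin

text \<open>
  If \<open>a \<circ> x = \<phi>(x) a x\<close> with \<open>\<phi>(x)\<close> in the annihilator, expanding \<open>a \<circ> (x y)\<close> by the left brace law
  gives \<open>\<phi>(x y) = \<phi>(x) \<phi>(y)\<close>, and expanding \<open>(a \<circ> x) \<circ> y = \<phi>(x) ((a x) \<circ> y)\<close> by the right brace law
  gives \<open>\<phi>(x \<circ> y) = \<phi>(x) \<phi>(y)\<close>.
\<close>

lemma left_star_trivial:
  assumes perfect: "perfect_brace G C" and a: "a \<in> second_ann" and x: "x \<in> carrier G"
  shows "a \<otimes>\<^bsub>C\<^esub> x = a \<otimes>\<^bsub>G\<^esub> x"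
proof -
  have ac: "a \<in> carrier G" using a by (simp add: second_ann_def)
  have "\<forall>u \<in> carrier G. \<exists>z \<in> brace_ann G C. a \<otimes>\<^bsub>C\<^esub> u = z \<otimes>\<^bsub>G\<^esub> (a \<otimes>\<^bsub>G\<^esub> u)"
    using a by (simp add: second_ann_def)
  then obtain \<phi> where \<phi>: "\<And>u. u \<in> carrier G \<Longrightarrow> \<phi> u \<in> brace_ann G C"
    and eq: "\<And>u. u \<in> carrier G \<Longrightarrow> a \<otimes>\<^bsub>C\<^esub> u = \<phi> u \<otimes>\<^bsub>G\<^esub> (a \<otimes>\<^bsub>G\<^esub> u)"
    by metis
  have \<phi>c: "\<phi> u \<in> carrier G" if "u \<in> carrier G" for u using ann_closed[OF \<phi>[OF that]] .
  have mult: "\<phi> (u \<otimes>\<^bsub>G\<^esub> v) = \<phi> u \<otimes>\<^bsub>G\<^esub> \<phi> v" if u: "u \<in> carrier G" and v: "v \<in> carrier G" for u v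
  proof -
    have "\<phi> (u \<otimes>\<^bsub>G\<^esub> v) \<otimes>\<^bsub>G\<^esub> (a \<otimes>\<^bsub>G\<^esub> (u \<otimes>\<^bsub>G\<^esub> v)) = (a \<otimes>\<^bsub>C\<^esub> u) \<otimes>\<^bsub>G\<^esub> inv\<^bsub>G\<^esub> a \<otimes>\<^bsub>G\<^esub> (a \<otimes>\<^bsub>C\<^esub> v)"
      using eq[of "u \<otimes>\<^bsub>G\<^esub> v"] brace[OF ac u v] u v by simp
    also have "\<dots> = (\<phi> u \<otimes>\<^bsub>G\<^esub> \<phi> v) \<otimes>\<^bsub>G\<^esub> (a \<otimes>\<^bsub>G\<^esub> (u \<otimes>\<^bsub>G\<^esub> v))"
      using ac u v \<phi>c by (simp add: eq G.m_assoc ann_left_comm \<phi> G.inv_solve_left')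
    finally show ?thesis using ac u v \<phi>c by simp
  qed
  have circ: "\<phi> (u \<otimes>\<^bsub>C\<^esub> v) = \<phi> u \<otimes>\<^bsub>G\<^esub> \<phi> v" if u: "u \<in> carrier G" and v: "v \<in> carrier G" for u v
  proof -
    have "\<phi> (u \<otimes>\<^bsub>C\<^esub> v) \<otimes>\<^bsub>G\<^esub> (a \<otimes>\<^bsub>G\<^esub> (u \<otimes>\<^bsub>C\<^esub> v)) = (a \<otimes>\<^bsub>C\<^esub> u) \<otimes>\<^bsub>C\<^esub> v"
      using eq[of "u \<otimes>\<^bsub>C\<^esub> v"] C_assoc[OF ac u v] u v by simp
    also have "\<dots> = \<phi> u \<otimes>\<^bsub>G\<^esub> ((a \<otimes>\<^bsub>C\<^esub> v) \<otimes>\<^bsub>G\<^esub> inv\<^bsub>G\<^esub> v \<otimes>\<^bsub>G\<^esub> (u \<otimes>\<^bsub>C\<^esub> v))"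
      using ac u v by (simp add: eq[OF u] ann_circ_left \<phi> right_brace)
    also have "\<dots> = (\<phi> u \<otimes>\<^bsub>G\<^esub> \<phi> v) \<otimes>\<^bsub>G\<^esub> (a \<otimes>\<^bsub>G\<^esub> (u \<otimes>\<^bsub>C\<^esub> v))"
      using ac u v \<phi>c by (simp add: eq[OF v] G.m_assoc[symmetric]) (simp add: G.m_assoc)
    finally show ?thesis using ac u v \<phi>c by simp
  qed
  have "group_hom G G \<phi>"
    by unfold_locales (auto simp: hom_def mult \<phi>c)
  then have "\<phi> x = \<one>\<^bsub>G\<^esub>"
    using perfect_hom_trivial[OF perfect _ circ x] by blast
  then show ?thesis using eq[OF x] ac x by simp
qed

text \<open>
  The mirror image of the previous lemma: now \<open>x \<circ> a = \<phi>(x) x a\<close>, the right brace law makes \<open>\<phi>\<close>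
  multiplicative for the dot and the left brace law for the circle.
\<close>

lemma right_star_trivial:
  assumes perfect: "perfect_brace G C" and a: "a \<in> second_ann" and x: "x \<in> carrier G"
  shows "x \<otimes>\<^bsub>C\<^esub> a = x \<otimes>\<^bsub>G\<^esub> a"
proof -
  have ac: "a \<in> carrier G" using a by (simp add: second_ann_def)
  have "\<forall>u \<in> carrier G. \<exists>z \<in> brace_ann G C. u \<otimes>\<^bsub>C\<^esub> a = z \<otimes>\<^bsub>G\<^esub> (u \<otimes>\<^bsub>G\<^esub> a)"
    using a by (simp add: second_ann_def)
  then obtain \<phi> where \<phi>: "\<And>u. u \<in> carrier G \<Longrightarrow> \<phi> u \<in> brace_ann G C"
    and eq: "\<And>u. u \<in> carrier G \<Longrightarrow> u \<otimes>\<^bsub>C\<^esub> a = \<phi> u \<otimes>\<^bsub>G\<^esub> (u \<otimes>\<^bsub>G\<^esub> a)"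
    by metis
  have \<phi>c: "\<phi> u \<in> carrier G" if "u \<in> carrier G" for u using ann_closed[OF \<phi>[OF that]] .
  have mult: "\<phi> (u \<otimes>\<^bsub>G\<^esub> v) = \<phi> u \<otimes>\<^bsub>G\<^esub> \<phi> v" if u: "u \<in> carrier G" and v: "v \<in> carrier G" for u v
  proof -
    have "\<phi> (u \<otimes>\<^bsub>G\<^esub> v) \<otimes>\<^bsub>G\<^esub> ((u \<otimes>\<^bsub>G\<^esub> v) \<otimes>\<^bsub>G\<^esub> a) = (u \<otimes>\<^bsub>C\<^esub> a) \<otimes>\<^bsub>G\<^esub> inv\<^bsub>G\<^esub> a \<otimes>\<^bsub>G\<^esub> (v \<otimes>\<^bsub>C\<^esub> a)"
      using eq[of "u \<otimes>\<^bsub>G\<^esub> v"] right_brace[OF ac u v] u v by simp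
    also have "\<dots> = \<phi> u \<otimes>\<^bsub>G\<^esub> (u \<otimes>\<^bsub>G\<^esub> (\<phi> v \<otimes>\<^bsub>G\<^esub> (v \<otimes>\<^bsub>G\<^esub> a)))"
      using ac u v \<phi>c by (simp add: eq G.m_assoc)
    also have "\<dots> = (\<phi> u \<otimes>\<^bsub>G\<^esub> \<phi> v) \<otimes>\<^bsub>G\<^esub> ((u \<otimes>\<^bsub>G\<^esub> v) \<otimes>\<^bsub>G\<^esub> a)"
      using ac u v \<phi>c by (simp add: ann_left_comm[OF \<phi>[OF v] u] G.m_assoc)
    finally show ?thesis using ac u v \<phi>c by simp
  qed
  have circ: "\<phi> (u \<otimes>\<^bsub>C\<^esub> v) = \<phi> u \<otimes>\<^bsub>G\<^esub> \<phi> v" if u: "u \<in> carrier G" and v: "v \<in> carrier G" for u v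
  proof -
    have "\<phi> (u \<otimes>\<^bsub>C\<^esub> v) \<otimes>\<^bsub>G\<^esub> ((u \<otimes>\<^bsub>C\<^esub> v) \<otimes>\<^bsub>G\<^esub> a) = u \<otimes>\<^bsub>C\<^esub> (v \<otimes>\<^bsub>C\<^esub> a)"
      using eq[of "u \<otimes>\<^bsub>C\<^esub> v"] C_assoc[OF u v ac] u v by simp
    also have "\<dots> = \<phi> v \<otimes>\<^bsub>G\<^esub> ((u \<otimes>\<^bsub>C\<^esub> v) \<otimes>\<^bsub>G\<^esub> inv\<^bsub>G\<^esub> u \<otimes>\<^bsub>G\<^esub> (u \<otimes>\<^bsub>C\<^esub> a))"
      using ac u v by (simp add: eq[OF v] ann_circ_right \<phi> brace)
    also have "\<dots> = \<phi> v \<otimes>\<^bsub>G\<^esub> (\<phi> u \<otimes>\<^bsub>G\<^esub> ((u \<otimes>\<^bsub>C\<^esub> v) \<otimes>\<^bsub>G\<^esub> inv\<^bsub>G\<^esub> u \<otimes>\<^bsub>G\<^esub> (u \<otimes>\<^bsub>G\<^esub> a)))"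
      using ac u v by (simp add: eq[OF u] ann_left_comm \<phi>)
    also have "\<dots> = (\<phi> u \<otimes>\<^bsub>G\<^esub> \<phi> v) \<otimes>\<^bsub>G\<^esub> ((u \<otimes>\<^bsub>C\<^esub> v) \<otimes>\<^bsub>G\<^esub> a)"
      using ac u v \<phi>c
      by (simp add: ann_comm[OF \<phi>[OF v] \<phi>c[OF u]] G.m_assoc[symmetric]) (simp add: G.m_assoc)
    finally show ?thesis using ac u v \<phi>c by simp
  qed
  have "group_hom G G \<phi>"
    by unfold_locales (auto simp: hom_def mult \<phi>c)
  then have "\<phi> x = \<one>\<^bsub>G\<^esub>"
    using perfect_hom_trivial[OF perfect _ circ x] by blast
  then show ?thesis using eq[OF x] ac x by simp
qed

text \<open>
  Write \<open>a x = \<phi>(x) x a\<close>.  By the two preceding lemmas this is also \<open>a \<circ> x = \<phi>(x) (x \<circ> a)\<close>, so in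
  either group \<open>a\<close> can be moved past a product at the cost of one factor \<open>\<phi>\<close> per letter.
\<close>

lemma commutator_trivial:
  assumes perfect: "perfect_brace G C" and a: "a \<in> second_ann" and x: "x \<in> carrier G"
  shows "a \<otimes>\<^bsub>G\<^esub> x = x \<otimes>\<^bsub>G\<^esub> a"
proof -
  note l = left_star_trivial[OF perfect a] and r = right_star_trivial[OF perfect a]
  have ac: "a \<in> carrier G" using a by (simp add: second_ann_def)
  have "\<forall>u \<in> carrier G. \<exists>z \<in> brace_ann G C. a \<otimes>\<^bsub>G\<^esub> u = z \<otimes>\<^bsub>G\<^esub> (u \<otimes>\<^bsub>G\<^esub> a)"
    using a by (simp add: second_ann_def)
  then obtain \<phi> where \<phi>: "\<And>u. u \<in> carrier G \<Longrightarrow> \<phi> u \<in> brace_ann G C"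
    and eq: "\<And>u. u \<in> carrier G \<Longrightarrow> a \<otimes>\<^bsub>G\<^esub> u = \<phi> u \<otimes>\<^bsub>G\<^esub> (u \<otimes>\<^bsub>G\<^esub> a)"
    by metis
  have \<phi>c: "\<phi> u \<in> carrier G" if "u \<in> carrier G" for u using ann_closed[OF \<phi>[OF that]] .
  have mult: "\<phi> (u \<otimes>\<^bsub>G\<^esub> v) = \<phi> u \<otimes>\<^bsub>G\<^esub> \<phi> v" if u: "u \<in> carrier G" and v: "v \<in> carrier G" for u v
  proof -
    have "\<phi> (u \<otimes>\<^bsub>G\<^esub> v) \<otimes>\<^bsub>G\<^esub> ((u \<otimes>\<^bsub>G\<^esub> v) \<otimes>\<^bsub>G\<^esub> a) = (a \<otimes>\<^bsub>G\<^esub> u) \<otimes>\<^bsub>G\<^esub> v"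
      using eq[of "u \<otimes>\<^bsub>G\<^esub> v"] ac u v by (simp add: G.m_assoc)
    also have "\<dots> = \<phi> u \<otimes>\<^bsub>G\<^esub> (u \<otimes>\<^bsub>G\<^esub> (a \<otimes>\<^bsub>G\<^esub> v))"
      using ac u v \<phi>c by (simp add: eq[OF u] G.m_assoc)
    also have "\<dots> = (\<phi> u \<otimes>\<^bsub>G\<^esub> \<phi> v) \<otimes>\<^bsub>G\<^esub> ((u \<otimes>\<^bsub>G\<^esub> v) \<otimes>\<^bsub>G\<^esub> a)"
      using ac u v \<phi>c by (simp add: eq[OF v] ann_left_comm[OF \<phi>[OF v] u] G.m_assoc)
    finally show ?thesis using ac u v \<phi>c by simp
  qed
  have circ: "\<phi> (u \<otimes>\<^bsub>C\<^esub> v) = \<phi> u \<otimes>\<^bsub>G\<^esub> \<phi> v" if u: "u \<in> carrier G" and v: "v \<in> carrier G" for u v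
  proof -
    have "\<phi> (u \<otimes>\<^bsub>C\<^esub> v) \<otimes>\<^bsub>G\<^esub> ((u \<otimes>\<^bsub>C\<^esub> v) \<otimes>\<^bsub>G\<^esub> a) = (a \<otimes>\<^bsub>C\<^esub> u) \<otimes>\<^bsub>C\<^esub> v"
      using eq[of "u \<otimes>\<^bsub>C\<^esub> v"] l[of "u \<otimes>\<^bsub>C\<^esub> v"] C_assoc[OF ac u v] u v by simp
    also have "\<dots> = (\<phi> u \<otimes>\<^bsub>G\<^esub> (u \<otimes>\<^bsub>C\<^esub> a)) \<otimes>\<^bsub>C\<^esub> v"
      using l[OF u] r[OF u] eq[OF u] by simp
    also have "\<dots> = \<phi> u \<otimes>\<^bsub>G\<^esub> (u \<otimes>\<^bsub>C\<^esub> (a \<otimes>\<^bsub>C\<^esub> v))"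
      using ac u v by (simp add: ann_circ_left \<phi> C_assoc)
    also have "\<dots> = \<phi> u \<otimes>\<^bsub>G\<^esub> (u \<otimes>\<^bsub>C\<^esub> (\<phi> v \<otimes>\<^bsub>G\<^esub> (v \<otimes>\<^bsub>C\<^esub> a)))"
      using l[OF v] r[OF v] eq[OF v] by simp
    also have "\<dots> = \<phi> u \<otimes>\<^bsub>G\<^esub> (\<phi> v \<otimes>\<^bsub>G\<^esub> ((u \<otimes>\<^bsub>C\<^esub> v) \<otimes>\<^bsub>C\<^esub> a))"
      using ac u v by (simp add: ann_circ_right \<phi> C_assoc)
    also have "\<dots> = (\<phi> u \<otimes>\<^bsub>G\<^esub> \<phi> v) \<otimes>\<^bsub>G\<^esub> ((u \<otimes>\<^bsub>C\<^esub> v) \<otimes>\<^bsub>G\<^esub> a)"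
      using ac u v \<phi>c r[of "u \<otimes>\<^bsub>C\<^esub> v"] by (simp add: G.m_assoc)
    finally show ?thesis using ac u v \<phi>c by simp
  qed
  have "group_hom G G \<phi>"
    by unfold_locales (auto simp: hom_def mult \<phi>c)
  then have "\<phi> x = \<one>\<^bsub>G\<^esub>"
    using perfect_hom_trivial[OF perfect _ circ x] by blast
  then show ?thesis using eq[OF x] ac x by simp
qed

lemma second_ann_subset_ann:
  assumes "perfect_brace G C"
  shows "second_ann \<subseteq> brace_ann G C"
proof
  fix a assume a: "a \<in> second_ann"
  then have "a \<in> carrier G" by (simp add: second_ann_def)
  then show "a \<in> brace_ann G C"
    unfolding ann_iff
    using left_star_trivial[OF assms a] right_star_trivial[OF assms a]
      commutator_trivial[OF assms a]
    by simp
qed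

end

section \<open>The annihilator of the quotient\<close>

theorem corollary1p8:
  fixes G :: "('a, 'b) monoid_scheme" and C :: "('a, 'c) monoid_scheme"
  assumes "two_sided_skew_brace G C"
    and "perfect_brace G C"
  shows "brace_ann (G Mod brace_ann G C) (C Mod brace_ann G C) =
    {\<one>\<^bsub>G Mod brace_ann G C\<^esub>}"
proof -
  interpret two_sided_skew_brace G C by (rule assms)
  let ?Z = "brace_ann G C"
  interpret Q: skew_brace "G Mod ?Z" "C Mod ?Z"
    by (rule quotient_skew_brace[OF ann_ideal])
  have s: "subgroup ?Z G"
    using ann_ideal normal_imp_subgroup by (auto simp: brace_ideal_def)
  show ?thesis
  proof (intro equalityI subsetI)
    fix X assume "X \<in> brace_ann (G Mod ?Z) (C Mod ?Z)"
    then obtain a where a: "a \<in> second_ann" and X: "X = ?Z #>\<^bsub>G\<^esub> a"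
      by (rule quotient_ann_representative)
    have "a \<in> ?Z" using second_ann_subset_ann[OF assms(2)] a by blast
    then have "X = ?Z" using X subgroup.rcos_const[OF s G.is_group] by simp
    then show "X \<in> {\<one>\<^bsub>G Mod ?Z\<^esub>}" by simp
  next
    fix X assume "X \<in> {\<one>\<^bsub>G Mod ?Z\<^esub>}"
    then show "X \<in> brace_ann (G Mod ?Z) (C Mod ?Z)"
      using Q.ann_ideal normal_imp_subgroup subgroup.one_closed
      unfolding brace_ideal_def by blast
  qed
qed

end
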